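(* For every integer $k\ge1$, the class of $k$-stack graphs has defective chromatic number and defective choice number equal to $k+1$. In particular, every $k$-stack graph is $(k+1,d_k)$-choosable for some $d_k=2^{O(k\log k)}$.
   Context: A $k$-stack layout of $G$ consists of a linear ordering $v_1,\dots,v_n$ of $V(G)$ and a partition $E_1,\dots,E_k$ of $E(G)$ such that for each $i$, no two edges in $E_i$ cross, where $v_av_b$ and $v_cv_d$ cross if $a<c<b<d$. A $k$-stack graph is a graph with a $k$-stack layout. $G$ is $(k,d)$-colourable if each vertex can be given one of $k$ colours so that each vertex has at most $d$ neighbours of its own colour; $(k,d)$-choosable if this holds with colours chosen from arbitrary lists $L(v)$ of exactly $k$ colours. The defective chromatic (resp. choice) number of a class is the minimum $k$ such that for some $d$ every graph in the class is $(k,d)$-colourable (resp. choosable). *)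

theory Defs
  imports
    Complex_Main
    "HOL-Library.Landau_Symbols"
    "HOL-Library.Extended_Nat"
    "HOL-Library.Disjoint_Sets"
    "HOL-Library.Infinite_Typeclass"
begin

text \<open>Graphs are finite, simple and undirected; an edge is the set of its two ends.\<close>

type_synonym 'a graph = "'a set \<times> 'a set set"

abbreviation verts :: "'a graph \<Rightarrow> 'a set" where
  "verts \<equiv> fst"

abbreviation edges :: "'a graph \<Rightarrow> 'a set set" where
  "edges \<equiv> snd"

definition is_graph :: "'a graph \<Rightarrow> bool" where
  "is_graph G \<longleftrightarrow> finite (verts G) \<and> (\<forall>e\<in>edges G. e \<subseteq> verts G \<and> card e = 2)"

text \<open>
  A list of distinct vertices encodes a linear ordering, up to indexing from \<open>0\<close>. The relation
  below is not symmetric in \<open>e\<close> and \<open>f\<close>: here \<open>e\<close> is the edge whose left end comes first.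
\<close>

definition crosses :: "'a list \<Rightarrow> 'a set \<Rightarrow> 'a set \<Rightarrow> bool" where
  "crosses vs e f \<longleftrightarrow>
     (\<exists>a b c d. a < c \<and> c < b \<and> b < d \<and> d < length vs \<and>
        e = {vs ! a, vs ! b} \<and> f = {vs ! c, vs ! d})"

text \<open>
  The parts of the edge partition may be empty, so a \<open>k\<close>-stack graph is also a
  \<open>(k + 1)\<close>-stack graph.
\<close>

definition stack_layout :: "nat \<Rightarrow> 'a graph \<Rightarrow> 'a list \<Rightarrow> (nat \<Rightarrow> 'a set set) \<Rightarrow> bool" where
  "stack_layout k G vs P \<longleftrightarrow>
     distinct vs \<and> set vs = verts G \<and>
     disjoint_family_on P {1..k} \<and> (\<Union>i\<in>{1..k}. P i) = edges G \<and>
     (\<forall>i\<in>{1..k}. \<forall>e\<in>P i. \<forall>f\<in>P i. \<not> crosses vs e f)"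

definition stack_graphs :: "nat \<Rightarrow> 'a graph set" where
  "stack_graphs k = {G. is_graph G \<and> (\<exists>vs P. stack_layout k G vs P)}"

definition has_defect :: "'a graph \<Rightarrow> ('a \<Rightarrow> 'c) \<Rightarrow> nat \<Rightarrow> bool" where
  "has_defect G c d \<longleftrightarrow>
     (\<forall>v\<in>verts G. card {u \<in> verts G. {u, v} \<in> edges G \<and> c u = c v} \<le> d)"

definition colourable :: "nat \<Rightarrow> nat \<Rightarrow> 'a graph \<Rightarrow> bool" where
  "colourable k d G \<longleftrightarrow> (\<exists>c :: 'a \<Rightarrow> nat. (\<forall>v\<in>verts G. c v \<in> {1..k}) \<and> has_defect G c d)"

text \<open>
  Colours in lists are natural numbers; this loses no generality, since a finite graph with finite
  lists involves only finitely many colours.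
\<close>

definition choosable :: "nat \<Rightarrow> nat \<Rightarrow> 'a graph \<Rightarrow> bool" where
  "choosable k d G \<longleftrightarrow>
     (\<forall>L :: 'a \<Rightarrow> nat set.
        (\<forall>v\<in>verts G. finite (L v) \<and> card (L v) = k) \<longrightarrow>
        (\<exists>c. (\<forall>v\<in>verts G. c v \<in> L v) \<and> has_defect G c d))"

text \<open>
  The minima are taken in \<^typ>\<open>enat\<close>, so that they are \<open>\<infinity>\<close> when no number of colours suffices.
\<close>

definition defective_chromatic_number :: "'a graph set \<Rightarrow> enat" where
  "defective_chromatic_number \<G> = Inf {enat k |k. \<exists>d. \<forall>G\<in>\<G>. colourable k d G}"

definition defective_choice_number :: "'a graph set \<Rightarrow> enat" where
  "defective_choice_number \<G> = Inf {enat k |k. \<exists>d. \<forall>G\<in>\<G>. choosable k d G}"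

end

theory Submission
  imports Defs "HOL-Real_Asymp.Real_Asymp"
begin

text \<open>
  Upper bound. A graph all of whose nonempty subgraphs have a vertex of degree at most \<open>k\<close> or an edge
  with both ends of degree at most \<open>l\<close> is \<open>(k + 1, l)\<close>-choosable: delete that vertex or that edge and
  extend the colouring. For a \<open>k\<close>-stack graph with minimum degree above \<open>k\<close>, let \<open>B\<close> be the set of
  vertices of degree above \<open>l\<close>. Each of the \<open>k\<close> stacks has at most \<open>2 n\<close> edges, so
  \<open>(l + 1) |B| \<le> 4 k n\<close>. If there is no edge as above, each vertex outside \<open>B\<close> has \<open>k + 1\<close> neighbours
  in \<open>B\<close>, two of them through the same stack; since the edges of a stack do not cross, there are at
  most \<open>3 |B|\<close> such vertices per stack, so \<open>n \<le> (3 k + 1) |B|\<close>. Hence \<open>l = 4 k (3 k + 1)\<close> suffices,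
  and the defect is even polynomial in \<open>k\<close>.

  Lower bound. Starting from a single vertex, put a dominating vertex in front of \<open>d + 1\<close> consecutive
  copies of the previous graph. The new star forms one new stack, and one of the copies avoids the
  colour of the new vertex unless that vertex has \<open>d + 1\<close> neighbours of its own colour.
\<close>

section \<open>Light edges and choosability\<close>

definition degree :: "'a graph \<Rightarrow> 'a \<Rightarrow> nat" where
  "degree G v = card {u \<in> verts G. {u, v} \<in> edges G}"

lemma card_same_colour_le_degree:
  assumes "finite (verts G)"
  shows "card {u \<in> verts G. {u, v} \<in> edges G \<and> c u = c v} \<le> degree G v"
  unfolding degree_def using assms by (intro card_mono) auto

lemma finite_edges:
  assumes "is_graph G" shows "finite (edges G)"
  using assms unfolding is_graph_def by (meson Pow_iff finite_Pow_iff finite_subset subsetI)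

text \<open>Induction on the number of vertices plus edges; quantifying over all subgraphs lets the
  hypothesis survive each deletion. A vertex of degree at most \<open>k\<close> is put back with a
  colour absent from its neighbours, so no monochromatic edge appears; a light edge is put back
  without recolouring.\<close>

lemma choosable_if_light_edges:
  fixes G :: "'a graph"
  assumes "is_graph G"
    and "\<And>H. is_graph H \<Longrightarrow> verts H \<subseteq> verts G \<Longrightarrow> edges H \<subseteq> edges G \<Longrightarrow> verts H \<noteq> {} \<Longrightarrow>
           (\<exists>v\<in>verts H. degree H v \<le> k) \<or>
           (\<exists>x y. {x, y} \<in> edges H \<and> degree H x \<le> l \<and> degree H y \<le> l)"
  shows "choosable (k + 1) l G"
  using assms
proof (induction "card (verts G) + card (edges G)" arbitrary: G rule: less_induct)
  case less
  obtain V E where G: "G = (V, E)" by (cases G)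
  have fin: "finite V" "finite E"
    using less.prems(1) finite_edges[OF less.prems(1)] by (auto simp: is_graph_def G)
  have sub: "e \<subseteq> V" "card e = 2" if "e \<in> E" for e
    using less.prems(1) that by (auto simp: is_graph_def G)
  show ?case
    unfolding choosable_def
  proof (intro allI impI)
    fix L :: "'a \<Rightarrow> nat set"
    assume L: "\<forall>v\<in>verts G. finite (L v) \<and> card (L v) = k + 1"
    consider (empty) "V = {}" | (deg) v where "v \<in> V" "degree G v \<le> k"
      | (light) x y where "{x, y} \<in> E" "degree G x \<le> l" "degree G y \<le> l"
      using less.prems(2)[of G] less.prems(1) by (auto simp: G)
    then show "\<exists>c. (\<forall>v\<in>verts G. c v \<in> L v) \<and> has_defect G c l"
    proof cases
      case empty
      then show ?thesis by (simp add: G has_defect_def)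
    next
      case deg
      define H where "H = (V - {v}, {e \<in> E. v \<notin> e})"
      have "is_graph H" using fin sub by (auto simp: H_def is_graph_def)
      moreover have "card (verts H) + card (edges H) < card (verts G) + card (edges G)"
        using deg(1) fin card_Diff1_less[of V v] card_mono[of E "{e \<in> E. v \<notin> e}"]
        by (auto simp: H_def G intro!: add_less_le_mono)
      ultimately have "choosable (k + 1) l H"
        using less.prems(2) by (intro less.hyps) (auto simp: H_def G)
      moreover have "\<forall>u\<in>verts H. finite (L u) \<and> card (L u) = k + 1"
        using L by (simp add: H_def G)
      ultimately obtain c where "\<forall>u\<in>verts H. c u \<in> L u" and cH: "has_defect H c l"
        unfolding choosable_def by blast
      then have c: "c u \<in> L u" if "u \<in> V - {v}" for u using that by (simp add: H_def)
      define N where "N = {u \<in> V. {u, v} \<in> E}"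
      \<comment> \<open>At most \<open>k\<close> neighbours occupy at most \<open>k\<close> of the
        \<open>k + 1\<close> colours in the list.\<close>
      have "card (c ` N) < card (L v)"
        using deg L fin card_image_le[of N c] by (auto simp: degree_def G N_def)
      then obtain col where col: "col \<in> L v" "col \<notin> c ` N"
        using fin card_mono[of "c ` N" "L v"] by (auto simp: N_def not_le)
      have vN: "v \<notin> N" using sub[of "{v}"] by (auto simp: N_def)
      have "has_defect G (c(v := col)) l"
        unfolding has_defect_def
      proof
        fix u assume u: "u \<in> verts G"
        show "card {w \<in> verts G. {w, u} \<in> edges G \<and> (c(v := col)) w = (c(v := col)) u} \<le> l"
        proof (cases "u = v")
          case True
          have "{w \<in> V. {w, u} \<in> E \<and> (c(v := col)) w = (c(v := col)) u} = {}"
            using col vN True by (auto simp: N_def)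
          then show ?thesis by (simp only: G fst_conv snd_conv card.empty le0)
        next
          case False
          have "c u \<noteq> col" if "{v, u} \<in> E"
            using col that u by (auto simp: N_def insert_commute G)
          then have "{w \<in> V. {w, u} \<in> E \<and> (c(v := col)) w = (c(v := col)) u}
              = {w \<in> verts H. {w, u} \<in> edges H \<and> c w = c u}"
            using False by (auto simp: H_def)
          moreover have "u \<in> verts H" using u False by (simp add: H_def G)
          ultimately show ?thesis
            using cH unfolding has_defect_def by (simp only: G fst_conv snd_conv)
        qed
      qed
      moreover have "\<forall>u\<in>verts G. (c(v := col)) u \<in> L u" using c col by (auto simp: G)
      ultimately show ?thesis by blast
    next
      case light
      define H where "H = (V, E - {{x, y}})"
      have "is_graph H" using fin sub by (auto simp: H_def is_graph_def)
      moreover have "card (verts H) + card (edges H) < card (verts G) + card (edges G)"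
        unfolding H_def G fst_conv snd_conv
        by (intro add_strict_left_mono card_Diff1_less fin light(1))
      ultimately have "choosable (k + 1) l H"
        using less.prems(2) by (intro less.hyps) (auto simp: H_def G)
      moreover have "\<forall>u\<in>verts H. finite (L u) \<and> card (L u) = k + 1"
        using L by (simp add: H_def G)
      ultimately obtain c where "\<forall>u\<in>verts H. c u \<in> L u" and cH: "has_defect H c l"
        unfolding choosable_def by blast
      then have c: "c u \<in> L u" if "u \<in> V" for u using that by (simp add: H_def)
      have "has_defect G c l"
        unfolding has_defect_def
      proof
        fix u assume u: "u \<in> verts G"
        show "card {w \<in> verts G. {w, u} \<in> edges G \<and> c w = c u} \<le> l"
        proof (cases "u \<in> {x, y}")
          \<comment> \<open>The degree of such an end in \<open>G\<close> itself is at most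
            \<open>l\<close>, so its defect is bounded under any colouring.\<close>
          case True
          then show ?thesis
            using light card_same_colour_le_degree[of G u c] fin by (auto simp: G)
        next
          case False
          then have "{w \<in> V. {w, u} \<in> E \<and> c w = c u}
              = {w \<in> verts H. {w, u} \<in> edges H \<and> c w = c u}"
            by (auto simp: H_def)
          moreover have "u \<in> verts H" using u by (simp add: H_def G)
          ultimately show ?thesis
            using cH unfolding has_defect_def by (simp only: G fst_conv snd_conv)
        qed
      qed
      then show ?thesis using c by (auto simp: G)
    qed
  qed
qed

section \<open>Counting in a single stack\<close>

text \<open>Positions given by a function instead of a list serve every subgraph unchanged: only
  injectivity on the vertex set has to be restricted.\<close>

definition noncrossing :: "('a \<Rightarrow> 'b::linorder) \<Rightarrow> 'a set set \<Rightarrow> bool" where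
  "noncrossing h F \<longleftrightarrow>
     (\<forall>a b c e. h a < h c \<and> h c < h b \<and> h b < h e \<and> {a, b} \<in> F \<longrightarrow> {c, e} \<notin> F)"

lemma noncrossingD:
  assumes "noncrossing h F" "{a, b} \<in> F" "{c, e} \<in> F" "h a < h c" "h c < h b"
  shows "h e \<le> h b"
  using assms unfolding noncrossing_def by (meson not_le)

text \<open>Every edge is the longest one to the right of its left end or to the left of its right end.\<close>

lemma card_noncrossing_le:
  assumes "finite V" "inj_on h V" "noncrossing h F"
  shows "card {(u, v). u \<in> V \<and> v \<in> V \<and> h u < h v \<and> {u, v} \<in> F} \<le> 2 * card V"
proof -
  define X where
    "X = {(u, v). u \<in> V \<and> v \<in> V \<and> {u, v} \<in> F \<and> (\<forall>w\<in>V. {u, w} \<in> F \<longrightarrow> h w \<le> h v)}"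
  define Y where
    "Y = {(u, v). u \<in> V \<and> v \<in> V \<and> {u, v} \<in> F \<and> (\<forall>w\<in>V. {w, v} \<in> F \<longrightarrow> h u \<le> h w)}"
  have "X \<subseteq> V \<times> V" "Y \<subseteq> V \<times> V" by (auto simp: X_def Y_def)
  then have fin: "finite X" "finite Y" using assms(1) by (meson finite_SigmaI finite_subset)+
  have "v = v'" if "(u, v) \<in> X" "(u, v') \<in> X" for u v v'
  proof -
    have "h v \<le> h v'" "h v' \<le> h v" using that by (auto simp: X_def)
    then show ?thesis using inj_onD[OF assms(2), of v v'] that by (auto simp: X_def)
  qed
  then have "inj_on fst X" by (metis inj_onI prod.collapse)
  then have X: "card X \<le> card V"
    using assms(1) by (intro card_inj_on_le[of fst]) (auto simp: X_def)
  have "u = u'" if "(u, v) \<in> Y" "(u', v) \<in> Y" for u u' v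
  proof -
    have "h u \<le> h u'" "h u' \<le> h u" using that by (auto simp: Y_def)
    then show ?thesis using inj_onD[OF assms(2), of u u'] that by (auto simp: Y_def)
  qed
  then have "inj_on snd Y" by (metis inj_onI prod.collapse)
  then have Y: "card Y \<le> card V"
    using assms(1) by (intro card_inj_on_le[of snd]) (auto simp: Y_def)
  \<comment> \<open>A pair outside both sets has an edge from \<open>u\<close> to some
    \<open>w\<close> beyond \<open>v\<close> and an edge from \<open>v\<close> to some
    \<open>w'\<close> before \<open>u\<close>; the edges \<open>{w', v}\<close> and
    \<open>{u, w}\<close> would cross.\<close>
  have "{(u, v). u \<in> V \<and> v \<in> V \<and> h u < h v \<and> {u, v} \<in> F} \<subseteq> X \<union> Y"
    using assms(3) unfolding X_def Y_def noncrossing_def by clarsimp (meson not_le)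
  then have "card {(u, v). u \<in> V \<and> v \<in> V \<and> h u < h v \<and> {u, v} \<in> F} \<le> card (X \<union> Y)"
    using fin by (intro card_mono) auto
  also have "\<dots> \<le> card X + card Y" by (rule card_Un_le)
  finally show ?thesis using X Y by simp
qed

text \<open>Both orientations of each edge are counted, which doubles the previous bound. Ordered
  pairs are what a sum of degrees counts.\<close>

lemma card_adjacent_pairs_le:
  assumes "finite V" "inj_on h V" "noncrossing h F"
  shows "card {(u, v). u \<in> V \<and> v \<in> V \<and> u \<noteq> v \<and> {u, v} \<in> F} \<le> 4 * card V"
proof -
  define D where "D = {(u, v). u \<in> V \<and> v \<in> V \<and> h u < h v \<and> {u, v} \<in> F}"
  have "D \<subseteq> V \<times> V" by (auto simp: D_def)
  then have fin: "finite D" using assms(1) by (meson finite_SigmaI finite_subset)+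
  have "{(u, v). u \<in> V \<and> v \<in> V \<and> u \<noteq> v \<and> {u, v} \<in> F} \<subseteq> D \<union> prod.swap ` D"
  proof clarify
    fix u v assume uv: "u \<in> V" "v \<in> V" "u \<noteq> v" "{u, v} \<in> F" "(u, v) \<notin> prod.swap ` D"
    have "h u \<noteq> h v" using uv assms(2) by (auto simp: inj_on_def)
    moreover have "(v, u) \<notin> D" using uv(5) by (metis image_eqI swap_simp)
    ultimately show "(u, v) \<in> D" using uv by (auto simp: D_def insert_commute)
  qed
  then have "card {(u, v). u \<in> V \<and> v \<in> V \<and> u \<noteq> v \<and> {u, v} \<in> F} \<le> card (D \<union> prod.swap ` D)"
    using fin by (intro card_mono) auto
  also have "\<dots> \<le> card D + card D"
    using card_Un_le[of D "prod.swap ` D"] card_image_le[OF fin, of prod.swap] by linarith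
  finally show ?thesis using card_noncrossing_le[OF assms] unfolding D_def by linarith
qed

text \<open>Two neighbours of \<open>a\<close> in \<open>B\<close> lie both to its right, both to
  its left, or on different sides. Each of these three classes injects into \<open>B\<close>, whence
  the factor 3.\<close>

lemma card_doubly_attached_le:
  assumes "finite A" "finite B" "A \<inter> B = {}" "inj_on h (A \<union> B)" "noncrossing h F"
  shows "card {a \<in> A. \<exists>b\<in>B. \<exists>b'\<in>B. b \<noteq> b' \<and> {a, b} \<in> F \<and> {a, b'} \<in> F} \<le> 3 * card B"
proof -
  define R where
    "R = {a \<in> A. \<exists>b\<in>B. \<exists>b'\<in>B. h a < h b \<and> h b < h b' \<and> {a, b} \<in> F \<and> {a, b'} \<in> F}"
  define L where
    "L = {a \<in> A. \<exists>b\<in>B. \<exists>b'\<in>B. h b' < h b \<and> h b < h a \<and> {a, b} \<in> F \<and> {a, b'} \<in> F}"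
  define M where
    "M = {a \<in> A. \<exists>b\<in>B. \<exists>b'\<in>B. h b < h a \<and> h a < h b' \<and> {a, b} \<in> F \<and> {a, b'} \<in> F}"
  have neq: "h a < h a' \<or> h a' < h a" if "a \<in> A \<union> B" "a' \<in> A \<union> B" "a \<noteq> a'" for a a'
    using assms(4) that by (metis inj_onD neqE)
  have eq: "a = a'" if "a \<in> A" "a' \<in> A" "\<not> h a < h a'" "\<not> h a' < h a" for a a'
    using neq that by blast
  have R: "card R \<le> card B"
  proof -
    \<comment> \<open>The nearer of two right neighbours determines \<open>a\<close>: if
      \<open>a\<close> comes before \<open>a'\<close> and both use \<open>b\<close>, then
      \<open>{a, b}\<close> crosses the edge from \<open>a'\<close> to its farther
      neighbour.\<close>
    define r where "r a b \<longleftrightarrow> h a < h b \<and> {a, b} \<in> F \<and> (\<exists>b'\<in>B. h b < h b' \<and> {a, b'} \<in> F)" for a b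
    have ex: "\<exists>b. b \<in> B \<and> r a b" if "a \<in> R" for a
      using that unfolding R_def r_def by blast
    have *: "\<not> h a < h a'" if "r a b" "r a' b" for a a' b
      using that noncrossingD[OF assms(5)] unfolding r_def by (meson not_le)
    have un: "a = a'" if "a \<in> R" "a' \<in> R" "r a b" "r a' b" for a a' b
      using eq *[OF that(3,4)] *[OF that(4,3)] that(1,2) unfolding R_def by blast
    show ?thesis using assms(2) ex un by (rule card_le_if_inj_on_rel)
  qed
  have L: "card L \<le> card B"
  proof -
    \<comment> \<open>Mirror image: now the edge from the earlier vertex \<open>a\<close> to its
      farther left neighbour crosses \<open>{b, a'}\<close>.\<close>
    define r where "r a b \<longleftrightarrow> h b < h a \<and> {a, b} \<in> F \<and> (\<exists>b'\<in>B. h b' < h b \<and> {a, b'} \<in> F)" for a b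
    have ex: "\<exists>b. b \<in> B \<and> r a b" if "a \<in> L" for a
      using that unfolding L_def r_def by blast
    have *: "\<not> h a < h a'" if ab: "r a b" "r a' b" for a a' b
    proof
      assume "h a < h a'"
      moreover obtain b' where "h b' < h b" "{b', a} \<in> F"
        using ab(1) by (auto simp: r_def insert_commute)
      moreover have "{b, a'} \<in> F" "h b < h a" using ab by (auto simp: r_def insert_commute)
      ultimately show False using noncrossingD[OF assms(5), of b' a b a'] by simp
    qed
    have un: "a = a'" if "a \<in> L" "a' \<in> L" "r a b" "r a' b" for a a' b
      using eq *[OF that(3,4)] *[OF that(4,3)] that(1,2) unfolding L_def by blast
    show ?thesis using assms(2) ex un by (rule card_le_if_inj_on_rel)
  qed
  text \<open>
    Two vertices of \<open>M\<close> are separated by a vertex of \<open>B\<close>, so the next vertex of \<open>B\<close> to the right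
    determines a vertex of \<open>M\<close>.
  \<close>
  have M: "card M \<le> card B"
  proof -
    define r where "r a b \<longleftrightarrow> h a < h b \<and> (\<forall>b'\<in>B. h a < h b' \<longrightarrow> h b \<le> h b')" for a b
    have ex: "\<exists>b. b \<in> B \<and> r a b" if "a \<in> M" for a
    proof -
      have "finite {b \<in> B. h a < h b}" "{b \<in> B. h a < h b} \<noteq> {}"
        using that assms(2) by (auto simp: M_def)
      then obtain b where "is_arg_min h (\<lambda>x. x \<in> {b \<in> B. h a < h b}) b"
        using ex_is_arg_min_if_finite by metis
      then have "b \<in> B" "h a < h b" "\<And>y. y \<in> B \<Longrightarrow> h a < h y \<Longrightarrow> \<not> h y < h b"
        by (auto simp: is_arg_min_def)
      then show ?thesis unfolding r_def by (meson not_le)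
    qed
    have *: "\<not> h a < h a'" if aa: "a \<in> M" "a' \<in> M" "r a b" "r a' b" for a a' b
    proof
      assume less: "h a < h a'"
      obtain b' where b': "b' \<in> B" "h a < h b'" "{a, b'} \<in> F" using aa(1) by (auto simp: M_def)
      obtain c where c: "c \<in> B" "h c < h a'" "{c, a'} \<in> F"
        using aa(2) by (auto simp: M_def insert_commute)
      have "h a' < h b" "h b \<le> h b'" using aa b' by (auto simp: r_def)
      \<comment> \<open>No vertex of \<open>B\<close> lies between \<open>a\<close> and
        \<open>a'\<close>, because the first one after \<open>a\<close> is \<open>b\<close>, which
        comes after \<open>a'\<close>. So \<open>c\<close> precedes \<open>a\<close>, and
        \<open>{c, a'}\<close> crosses \<open>{a, b'}\<close>.\<close>
      moreover have "\<not> h a < h c" using aa(3,4) c by (force simp: r_def)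
      moreover have "a \<noteq> c" using aa(1) c assms(3) by (auto simp: M_def)
      ultimately have "h c < h a" "h a' < h b'"
        using neq[of a c] aa(1) c by (auto simp: M_def)
      then show False using noncrossingD[OF assms(5) c(3) b'(3)] less by simp
    qed
    have un: "a = a'" if "a \<in> M" "a' \<in> M" "r a b" "r a' b" for a a' b
      using eq *[OF that] *[OF that(2,1,4,3)] that(1,2) unfolding M_def by blast
    show ?thesis using assms(2) ex un by (rule card_le_if_inj_on_rel)
  qed
  have "{a \<in> A. \<exists>b\<in>B. \<exists>b'\<in>B. b \<noteq> b' \<and> {a, b} \<in> F \<and> {a, b'} \<in> F} \<subseteq> R \<union> L \<union> M"
  proof clarify
    fix a b b'
    assume *: "a \<in> A" "b \<in> B" "b' \<in> B" "b \<noteq> b'" "{a, b} \<in> F" "{a, b'} \<in> F"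
      "a \<notin> M" "a \<notin> L"
    then have "a \<noteq> b" "a \<noteq> b'" using assms(3) by auto
    then show "a \<in> R"
      using neq[of a b] neq[of a b'] neq[of b b'] * unfolding R_def L_def M_def by blast
  qed
  moreover have "finite (R \<union> L \<union> M)" using assms(1) by (simp add: R_def L_def M_def)
  ultimately have
    "card {a \<in> A. \<exists>b\<in>B. \<exists>b'\<in>B. b \<noteq> b' \<and> {a, b} \<in> F \<and> {a, b'} \<in> F} \<le> card (R \<union> L \<union> M)"
    by (intro card_mono)
  also have "\<dots> \<le> card R + card L + card M"
    using card_Un_le[of "R \<union> L" M] card_Un_le[of R L] by linarith
  finally show ?thesis using R L M by linarith
qed

section \<open>Light edges in stack graphs\<close>

text \<open>The position function is the index in \<open>vs\<close>. It is meaningful only on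
  vertices, which suffices because every edge lies inside the vertex set.\<close>

lemma stack_layout_noncrossing:
  assumes "is_graph G" "stack_layout k G vs P"
  obtains h :: "'a \<Rightarrow> nat" where "inj_on h (verts (G :: 'a graph))" "\<forall>i\<in>{1..k}. noncrossing h (P i)"
proof -
  have dist: "distinct vs" and vs: "set vs = verts G"
    using assms(2) by (auto simp: stack_layout_def)
  define h where "h = the_inv_into {..<length vs} (nth vs)"
  have inj: "inj_on (nth vs) {..<length vs}" using dist by (intro inj_on_nth) auto
  have img: "nth vs ` {..<length vs} = verts G" using vs by (auto simp: set_conv_nth)
  have h: "h v < length vs" "vs ! h v = v" if "v \<in> verts G" for v
    using the_inv_into_into[OF inj, of v] f_the_inv_into_f[OF inj, of v] img that
    by (auto simp: h_def)
  have "inj_on h (verts G)" using h by (metis inj_onI)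
  moreover have "noncrossing h (P i)" if i: "i \<in> {1..k}" for i
    unfolding noncrossing_def
  proof (intro allI impI notI; elim conjE)
    fix a b c e
    assume *: "h a < h c" "h c < h b" "h b < h e" "{a, b} \<in> P i" "{c, e} \<in> P i"
    have "P i \<subseteq> edges G" using assms(2) i by (auto simp: stack_layout_def)
    then have "{a, b} \<subseteq> verts G" "{c, e} \<subseteq> verts G"
      using *(4,5) assms(1) unfolding is_graph_def by blast+
    then have "crosses vs {a, b} {c, e}"
      unfolding crosses_def using * h
      by (intro exI[of _ "h a"] exI[of _ "h b"] exI[of _ "h c"] exI[of _ "h e"]) auto
    then show False using assms(2) i * unfolding stack_layout_def by blast
  qed
  ultimately show ?thesis using that by blast
qed

text \<open>Double counting between vertices of small degree (\<open>A\<close>) and large degree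
  (\<open>B\<close>). The sets \<open>P i\<close> are asked to cover the edges rather than to
  partition them, so a subgraph can keep the stacks of the whole graph.\<close>

lemma light_edge_if_noncrossing:
  fixes G :: "'a graph" and h :: "'a \<Rightarrow> 'b::linorder"
  assumes G: "is_graph G" "verts G \<noteq> {}" and h: "inj_on h (verts G)"
    and I: "finite I" "edges G \<subseteq> (\<Union>i\<in>I. P i)" "\<And>i. i \<in> I \<Longrightarrow> noncrossing h (P i)"
    and deg: "\<And>v. v \<in> verts G \<Longrightarrow> card I < degree G v"
  shows "\<exists>x y. {x, y} \<in> edges G \<and> degree G x \<le> 4 * card I * (3 * card I + 1)
                              \<and> degree G y \<le> 4 * card I * (3 * card I + 1)"
proof (rule ccontr)
  define V where "V = verts G"
  define E where "E = edges G"
  define k where "k = card I"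
  define l where "l = 4 * k * (3 * k + 1)"
  define A where "A = {v \<in> V. degree G v \<le> l}"
  define B where "B = {v \<in> V. l < degree G v}"
  define N where "N v = {u \<in> V. {u, v} \<in> E}" for v
  assume "\<not> ?thesis"
  then have light: "\<not> (degree G x \<le> l \<and> degree G y \<le> l)" if "{x, y} \<in> E" for x y
    using that by (auto simp: E_def l_def k_def)
  have fin: "finite V" "V \<noteq> {}" using G by (auto simp: V_def is_graph_def)
  have V: "V = A \<union> B" "A \<inter> B = {}" by (auto simp: A_def B_def)
  then have finAB: "finite A" "finite B" using fin by auto
  have degN: "degree G v = card (N v)" for v by (simp add: degree_def N_def V_def E_def)
  have noloop: "u \<noteq> v" if "u \<in> N v" for u v
    using G(1) that unfolding is_graph_def N_def E_def by force

  \<comment> \<open>First count: the degree sum over \<open>B\<close> is at most the number of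
    adjacent ordered pairs in all stacks together, so \<open>B\<close> is small compared with
    \<open>V\<close>.\<close>
  have "(l + 1) * card B = (\<Sum>v\<in>B. l + 1)" by simp
  also have "\<dots> \<le> (\<Sum>v\<in>B. card (N v))"
    by (intro sum_mono) (auto simp: B_def degN)
  also have "\<dots> = card (SIGMA v:B. N v)"
    using finAB fin by (intro card_SigmaI[symmetric]) (auto simp: N_def)
  also have "\<dots> \<le> card (\<Union>i\<in>I. {(u, v). u \<in> V \<and> v \<in> V \<and> u \<noteq> v \<and> {u, v} \<in> P i})"
  proof (rule card_mono)
    have "(\<Union>i\<in>I. {(u, v). u \<in> V \<and> v \<in> V \<and> u \<noteq> v \<and> {u, v} \<in> P i}) \<subseteq> V \<times> V" by auto
    then show "finite (\<Union>i\<in>I. {(u, v). u \<in> V \<and> v \<in> V \<and> u \<noteq> v \<and> {u, v} \<in> P i})"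
      using fin by (meson finite_SigmaI finite_subset)
    show "(SIGMA v:B. N v) \<subseteq> (\<Union>i\<in>I. {(u, v). u \<in> V \<and> v \<in> V \<and> u \<noteq> v \<and> {u, v} \<in> P i})"
    proof clarify
      fix v u assume *: "v \<in> B" "u \<in> N v"
      then have "{v, u} \<in> E" "v \<in> V" "u \<in> V" "v \<noteq> u"
        using noloop by (auto simp: N_def B_def insert_commute)
      then show "(v, u) \<in> (\<Union>i\<in>I. {(u, v). u \<in> V \<and> v \<in> V \<and> u \<noteq> v \<and> {u, v} \<in> P i})"
        using I(2) by (auto simp: E_def)
    qed
  qed
  also have "\<dots> \<le> (\<Sum>i\<in>I. card {(u, v). u \<in> V \<and> v \<in> V \<and> u \<noteq> v \<and> {u, v} \<in> P i})"
    using I(1) by (rule card_UN_le)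
  also have "\<dots> \<le> (\<Sum>i\<in>I. 4 * card V)"
    using fin h I(3) by (intro sum_mono card_adjacent_pairs_le) (auto simp: V_def)
  also have "\<dots> = 4 * k * card V" by (simp add: k_def)
  finally have B: "(l + 1) * card B \<le> 4 * k * card V" .

  \<comment> \<open>Second count: without a light edge \<open>A\<close> is independent, so a vertex
    of \<open>A\<close> has more than \<open>k\<close> neighbours in \<open>B\<close>, and by
    pigeonhole two of them are reached through the same stack.\<close>
  have "A \<subseteq> (\<Union>i\<in>I. {a \<in> A. \<exists>b\<in>B. \<exists>b'\<in>B. b \<noteq> b' \<and> {a, b} \<in> P i \<and> {a, b'} \<in> P i})"
  proof
    fix a assume a: "a \<in> A"
    have NB: "N a \<subseteq> B" using light a by (force simp: N_def A_def B_def)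
    have "\<forall>b\<in>N a. \<exists>i\<in>I. {b, a} \<in> P i" using I(2) by (auto simp: N_def E_def)
    then obtain s where s: "\<And>b. b \<in> N a \<Longrightarrow> s b \<in> I \<and> {b, a} \<in> P (s b)" by metis
    have "card (s ` N a) \<le> card I" using s I(1) by (intro card_mono) auto
    also have "\<dots> < card (N a)" using deg[of a] a by (auto simp: degN A_def V_def)
    finally have "\<not> inj_on s (N a)" by (rule pigeonhole)
    then obtain b b' where b: "b \<in> N a" "b' \<in> N a" "b \<noteq> b'" "s b = s b'"
      by (auto simp: inj_on_def)
    then have "{a, b} \<in> P (s b)" "{a, b'} \<in> P (s b)" "s b \<in> I"
      using s[of b] s[of b'] by (auto simp: insert_commute)
    then show "a \<in> (\<Union>i\<in>I. {a \<in> A. \<exists>b\<in>B. \<exists>b'\<in>B. b \<noteq> b' \<and> {a, b} \<in> P i \<and> {a, b'} \<in> P i})"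
      using b NB a by blast
  qed
  then have "card A \<le> card (\<Union>i\<in>I. {a \<in> A. \<exists>b\<in>B. \<exists>b'\<in>B. b \<noteq> b' \<and> {a, b} \<in> P i \<and> {a, b'} \<in> P i})"
    using finAB I(1) by (intro card_mono) auto
  also have "\<dots> \<le> (\<Sum>i\<in>I. card {a \<in> A. \<exists>b\<in>B. \<exists>b'\<in>B. b \<noteq> b' \<and> {a, b} \<in> P i \<and> {a, b'} \<in> P i})"
    using I(1) by (rule card_UN_le)
  also have "\<dots> \<le> (\<Sum>i\<in>I. 3 * card B)"
    using finAB h I(3) V by (intro sum_mono card_doubly_attached_le) (auto simp: V_def)
  also have "\<dots> = 3 * k * card B" by (simp add: k_def)
  finally have A: "card A \<le> 3 * k * card B" .

  have "card V = card A + card B" using V finAB by (simp add: card_Un_disjoint)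
  then have n: "card V \<le> (3 * k + 1) * card B" using A by (simp add: algebra_simps)
  have "card V > 0" using fin by (simp add: card_gt_0_iff)
  \<comment> \<open>Nonemptiness of \<open>B\<close> makes the final inequality strict.\<close>
  then have "card B > 0" using n by (cases "card B") auto
  \<comment> \<open>The value of \<open>l\<close> is exactly the product of the factors
    \<open>4 * k\<close> and \<open>3 * k + 1\<close> from the two counts.\<close>
  have "(l + 1) * card B \<le> 4 * k * ((3 * k + 1) * card B)"
    using B n by (meson le_trans mult_le_mono2)
  also have "\<dots> = l * card B" by (simp only: l_def mult.assoc)
  finally show False using \<open>card B > 0\<close> by simp
qed

text \<open>The ordering and the stacks of \<open>G\<close> serve each subgraph \<open>H\<close>. If
  all degrees in \<open>H\<close> exceed \<open>k\<close>, the counting lemma with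
  \<open>I = {1..k}\<close> yields a light edge.\<close>

lemma stack_graph_choosable:
  assumes "G \<in> stack_graphs k"
  shows "choosable (k + 1) (4 * k * (3 * k + 1)) G"
proof -
  obtain vs P where G: "is_graph G" "stack_layout k G vs P"
    using assms by (auto simp: stack_graphs_def)
  then obtain h :: "'a \<Rightarrow> nat" where
    h: "inj_on h (verts G)" "\<forall>i\<in>{1..k}. noncrossing h (P i)"
    using stack_layout_noncrossing by blast
  have E: "edges G = (\<Union>i\<in>{1..k}. P i)" using G(2) by (simp add: stack_layout_def)
  show ?thesis
  proof (rule choosable_if_light_edges[OF G(1)])
    fix H :: "'a graph"
    assume H: "is_graph H" "verts H \<subseteq> verts G" "edges H \<subseteq> edges G" "verts H \<noteq> {}"
    show "(\<exists>v\<in>verts H. degree H v \<le> k) \<or>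
      (\<exists>x y. {x, y} \<in> edges H \<and> degree H x \<le> 4 * k * (3 * k + 1) \<and> degree H y \<le> 4 * k * (3 * k + 1))"
    proof (rule disjCI)
      assume "\<not> (\<exists>x y. {x, y} \<in> edges H \<and> degree H x \<le> 4 * k * (3 * k + 1)
                                       \<and> degree H y \<le> 4 * k * (3 * k + 1))"
      then show "\<exists>v\<in>verts H. degree H v \<le> k"
        using light_edge_if_noncrossing[OF H(1,4) inj_on_subset[OF h(1) H(2)], of "{1..k}" P]
          h(2) H(3) unfolding E card_atLeastAtMost by (auto simp: not_le[symmetric])
    qed
  qed
qed

section \<open>Stack graphs that need many colours\<close>

text \<open>The pairs \<open>(a, b)\<close> in \<open>P p\<close> are the edges of stack \<open>p\<close> on vertices \<open>0, \<dots>, N - 1\<close>, in this order.\<close>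

definition hard_stacks :: "nat \<Rightarrow> nat \<Rightarrow> nat \<Rightarrow> (nat \<Rightarrow> (nat \<times> nat) set) \<Rightarrow> bool" where
  "hard_stacks d k N P \<longleftrightarrow>
     (\<forall>p a b. (a, b) \<in> P p \<longrightarrow> a < b \<and> b < N \<and> p \<in> {1..k}) \<and>
     (\<forall>p q a b. (a, b) \<in> P p \<longrightarrow> (a, b) \<in> P q \<longrightarrow> p = q) \<and>
     (\<forall>p a b c e. (a, b) \<in> P p \<longrightarrow> (c, e) \<in> P p \<longrightarrow> \<not> (a < c \<and> c < b \<and> b < e)) \<and>
     (\<forall>(c :: nat \<Rightarrow> nat) C. finite C \<longrightarrow> card C = k \<longrightarrow> c ` {..<N} \<subseteq> C \<longrightarrow>
        (\<exists>v<N. d < card {u. u < N \<and> (\<exists>p. (u, v) \<in> P p \<or> (v, u) \<in> P p) \<and> c u = c v}))"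

lemma hard_stacksD:
  fixes f :: "nat \<Rightarrow> nat"
  assumes "hard_stacks d k N P"
  shows "(a, b) \<in> P p \<Longrightarrow> a < b \<and> b < N \<and> p \<in> {1..k}"
    and "(a, b) \<in> P p \<Longrightarrow> (a, b) \<in> P q \<Longrightarrow> p = q"
    and "(a, b) \<in> P p \<Longrightarrow> (c, e) \<in> P p \<Longrightarrow> \<not> (a < c \<and> c < b \<and> b < e)"
    and "finite C \<Longrightarrow> card C = k \<Longrightarrow> f ` {..<N} \<subseteq> C \<Longrightarrow>
      \<exists>v<N. d < card {u. u < N \<and> (\<exists>p. (u, v) \<in> P p \<or> (v, u) \<in> P p) \<and> f u = f v}"
  using assms unfolding hard_stacks_def by simp_all

text \<open>The palette \<open>C\<close> in \<open>hard_stacks\<close> is an arbitrary set of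
  \<open>k\<close> colours, so that the induction hypothesis applies after the colour of the new
  vertex is removed.\<close>

lemma exists_hard_stacks: "\<exists>N P. hard_stacks d k N P"
proof (induction k)
  case 0
  \<comment> \<open>With an empty palette the single vertex cannot be coloured, so the colouring
    condition is vacuous; this needs at least one vertex.\<close>
  show ?case by (intro exI[of _ 1] exI[of _ "\<lambda>_. {}"]) (auto simp: hard_stacks_def)
next
  case (Suc k)
  then obtain N P where NP: "hard_stacks d k N P" by blast
  note P = hard_stacksD(1)[OF NP] and disj = hard_stacksD(2)[OF NP]
    and cross = hard_stacksD(3)[OF NP] and col = hard_stacksD(4)[OF NP]
  \<comment> \<open>Position 0 is the new dominating vertex, followed by \<open>d + 1\<close> blocks
    of length \<open>N\<close>; \<open>s i a\<close> is vertex \<open>a\<close> of copy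
    \<open>i\<close>, and \<open>Suc k\<close> is the stack of the star.\<close>
  define M where "M = 1 + (d + 1) * N"
  define s where "s i a = 1 + i * N + a" for i a
  define Q where "Q p = (if p = Suc k then {(0, b) | b. 0 < b \<and> b < M}
      else {(s i a, s i b) | i a b. i \<le> d \<and> (a, b) \<in> P p})" for p
  \<comment> \<open>Integer division recovers the copy from the position, so the copies form
    consecutive disjoint intervals.\<close>
  have div: "(s i a - 1) div N = i" if "a < N" for i a using that by (simp add: s_def)
  have block_le: "i \<le> j" if "s i a \<le> s j b" "a < N" "b < N" for i j a b
    using div_le_mono[of "s i a - 1" "s j b - 1" N] div[of a i] div[of b j] that by simp
  have s_eq: "i = j \<and> a = b" if "s i a = s j b" "a < N" "b < N" for i j a b
  proof -
    have "i = j" using block_le[of i a j b] block_le[of j b i a] that by simp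
    then show ?thesis using that by (simp add: s_def)
  qed
  have s_less: "s i a < M" if "a < N" "i \<le> d" for i a
  proof -
    have "i * N + a < (i + 1) * N" using that(1) by simp
    also have "\<dots> \<le> (d + 1) * N" using that(2) by (intro mult_le_mono1) simp
    finally show ?thesis by (simp add: s_def M_def)
  qed
  have Q: "a < b \<and> b < M \<and> p \<in> {1..Suc k}" if ab: "(a, b) \<in> Q p" for p a b
  proof (cases "p = Suc k")
    case True
    then show ?thesis using ab by (auto simp: Q_def)
  next
    case False
    then obtain i a' b' where "i \<le> d" "(a', b') \<in> P p" "a = s i a'" "b = s i b'"
      using ab by (auto simp: Q_def)
    moreover have "s i a' < s i b'" if "a' < b'" using that by (simp add: s_def)
    ultimately show ?thesis using P[of a' b' p] s_less[of b' i] by auto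
  qed
  have old: "\<exists>i a' b'. i \<le> d \<and> (a', b') \<in> P p \<and> a = s i a' \<and> b = s i b'"
    if "(a, b) \<in> Q p" "p \<noteq> Suc k" for p a b
    using that by (auto simp: Q_def)
  have "p = q" if pq: "(a, b) \<in> Q p" "(a, b) \<in> Q q" for p q a b
  proof -
    \<comment> \<open>Positions in the copies are at least 1, so the left end 0 singles out the
      star.\<close>
    have new: "a = 0 \<longleftrightarrow> p = Suc k" if "(a, b) \<in> Q p" for p
      using that by (auto simp: Q_def s_def split: if_splits)
    show ?thesis
    proof (cases "a = 0")
      case True
      then show ?thesis using new pq by blast
    next
      case False
      then have "p \<noteq> Suc k" "q \<noteq> Suc k" using new pq by auto
      then obtain i a' b' j a'' b'' where
        *: "(a', b') \<in> P p" "(a'', b'') \<in> P q" "s i a' = s j a''" "s i b' = s j b''"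
        using old[OF pq(1)] old[OF pq(2)] by metis
      have "a' < N" "a'' < N" "b' < N" "b'' < N" using P[OF *(1)] P[OF *(2)] by auto
      then have "a' = a''" "b' = b''" using s_eq *(3,4) by blast+
      then show ?thesis using disj * by blast
    qed
  qed
  moreover have "\<not> (a < c \<and> c < b \<and> b < e)" if pq: "(a, b) \<in> Q p" "(c, e) \<in> Q p" for p a b c e
  proof (cases "p = Suc k")
    case True
    then show ?thesis using pq by (auto simp: Q_def)
  next
    case False
    then obtain i a' b' j c' e' where
      *: "(a', b') \<in> P p" "(c', e') \<in> P p" "a = s i a'" "b = s i b'" "c = s j c'" "e = s j e'"
      using old[OF pq(1)] old[OF pq(2)] by metis
    have N: "a' < N" "b' < N" "c' < N" using P[OF *(1)] P[OF *(2)] by auto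
    show ?thesis
    proof
      assume less: "a < c \<and> c < b \<and> b < e"
      \<comment> \<open>The vertex \<open>c\<close> lies between two vertices of copy
        \<open>i\<close>, which is an interval, so both edges come from the same copy.\<close>
      then have "i = j" using block_le[of i a' j c'] block_le[of j c' i b'] N * by simp
      then show False using cross[OF *(1,2)] less * by (simp add: s_def)
    qed
  qed
  moreover have "\<exists>v<M. d < card {u. u < M \<and> (\<exists>p. (u, v) \<in> Q p \<or> (v, u) \<in> Q p) \<and> c u = c v}"
    if C: "finite C" "card C = Suc k" "c ` {..<M} \<subseteq> C" for c :: "nat \<Rightarrow> nat" and C
  proof (cases "\<forall>i\<le>d. \<exists>a<N. c (s i a) = c 0")
    case True
    \<comment> \<open>One vertex coloured like 0 in each copy gives \<open>d + 1\<close> neighbours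
      of 0 in its own colour.\<close>
    then obtain g where g: "\<And>i. i \<le> d \<Longrightarrow> g i < N \<and> c (s i (g i)) = c 0" by metis
    have "inj_on (\<lambda>i. s i (g i)) {..d}" using g s_eq by (intro inj_onI) (metis atMost_iff)
    then have "Suc d = card ((\<lambda>i. s i (g i)) ` {..d})" by (simp add: card_image)
    also have "\<dots> \<le> card {u. u < M \<and> (\<exists>p. (u, 0) \<in> Q p \<or> (0, u) \<in> Q p) \<and> c u = c 0}"
    proof (rule card_mono)
      show "(\<lambda>i. s i (g i)) ` {..d} \<subseteq> {u. u < M \<and> (\<exists>p. (u, 0) \<in> Q p \<or> (0, u) \<in> Q p) \<and> c u = c 0}"
        using g s_less by (auto simp: Q_def s_def intro!: exI[of _ "Suc k"])
    qed simp
    finally show ?thesis by (intro exI[of _ 0]) (simp add: M_def)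
  next
    case False
    \<comment> \<open>Copy \<open>i\<close> avoids the colour of 0, so it is coloured from only
      \<open>k\<close> colours and contains a bad vertex by induction.\<close>
    then obtain i where i: "i \<le> d" "\<And>a. a < N \<Longrightarrow> c (s i a) \<noteq> c 0" by blast
    have "c 0 \<in> C" using C(3) by (auto simp: M_def)
    then have "card (C - {c 0}) = k" using C(1,2) by simp
    moreover have "(\<lambda>a. c (s i a)) ` {..<N} \<subseteq> C - {c 0}"
      using i s_less C(3) by (auto simp: image_subset_iff)
    ultimately obtain v where v: "v < N"
      "d < card {u. u < N \<and> (\<exists>p. (u, v) \<in> P p \<or> (v, u) \<in> P p) \<and> c (s i u) = c (s i v)}"
      (is "_ < card ?S") using col[of "C - {c 0}" "\<lambda>a. c (s i a)"] C(1) by blast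
    have "card ?S = card (s i ` ?S)"
      by (rule card_image[symmetric]) (auto simp: inj_on_def s_def)
    also have "\<dots> \<le> card {u. u < M \<and> (\<exists>p. (u, s i v) \<in> Q p \<or> (s i v, u) \<in> Q p) \<and> c u = c (s i v)}"
    proof (rule card_mono)
      have "(s i a, s i b) \<in> Q p" if "(a, b) \<in> P p" for a b p
        using that P[OF that] i by (auto simp: Q_def)
      then show "s i ` ?S \<subseteq>
          {u. u < M \<and> (\<exists>p. (u, s i v) \<in> Q p \<or> (s i v, u) \<in> Q p) \<and> c u = c (s i v)}"
        using s_less i by auto
    qed simp
    finally show ?thesis using v s_less i by (intro exI[of _ "s i v"]) auto
  qed
  ultimately have "hard_stacks d (Suc k) M Q" using Q unfolding hard_stacks_def by blast
  then show ?case by blast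
qed

text \<open>The numbered construction is carried into an arbitrary infinite vertex type by an
  injection \<open>g\<close> of the natural numbers.\<close>

lemma exists_stack_graph_not_colourable:
  "\<exists>G \<in> (stack_graphs k :: 'a::infinite graph set). \<not> colourable k d G"
proof -
  obtain N P where NP: "hard_stacks d k N P" using exists_hard_stacks by blast
  note P = hard_stacksD(1)[OF NP] and disj = hard_stacksD(2)[OF NP]
    and cross = hard_stacksD(3)[OF NP] and col = hard_stacksD(4)[OF NP]
  obtain g :: "nat \<Rightarrow> 'a" where g: "inj g"
    using infinite_UNIV infinite_countable_subset by blast
  have geq: "g a = g b \<longleftrightarrow> a = b" for a b using g by (simp add: inj_eq)
  define Q where "Q p = {{g a, g b} | a b. (a, b) \<in> P p}" for p
  define G where "G = (g ` {..<N}, \<Union>p\<in>{1..k}. Q p)"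
  \<comment> \<open>Pairs in \<open>P p\<close> are increasing, so an unordered edge determines its
    pair.\<close>
  have Q: "(a, b) \<in> P p" if "{g a, g b} \<in> Q p" "a < b" for a b p
    using that P by (auto simp: Q_def doubleton_eq_iff geq dest: less_asym)
  have "is_graph G"
    using P by (fastforce simp: is_graph_def G_def Q_def card_2_iff geq)
  moreover have "stack_layout k G (map g [0..<N]) Q"
    unfolding stack_layout_def
  proof (intro conjI ballI)
    show "distinct (map g [0..<N])" using g by (simp add: distinct_map inj_on_def)
    show "set (map g [0..<N]) = verts G" by (simp add: G_def lessThan_atLeast0)
    show "disjoint_family_on Q {1..k}"
      unfolding disjoint_family_on_def
    proof (intro ballI impI)
      fix p q :: nat assume "p \<noteq> q"
      have "e \<notin> Q q" if "e \<in> Q p" for e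
      proof
        assume e: "e \<in> Q q"
        obtain a b where "e = {g a, g b}" "(a, b) \<in> P p" using \<open>e \<in> Q p\<close> by (auto simp: Q_def)
        then show False using Q e P disj \<open>p \<noteq> q\<close> by metis
      qed
      then show "Q p \<inter> Q q = {}" by blast
    qed
    show "(\<Union>i\<in>{1..k}. Q i) = edges G" by (simp add: G_def)
    fix p e f
    assume ef: "e \<in> Q p" "f \<in> Q p"
    show "\<not> crosses (map g [0..<N]) e f"
    proof
      assume "crosses (map g [0..<N]) e f"
      then obtain a b c d where *: "a < c" "c < b" "b < d" "e = {g a, g b}" "f = {g c, g d}"
        unfolding crosses_def by auto
      then have "(a, b) \<in> P p" "(c, d) \<in> P p" using Q ef by auto
      then show False using cross * by blast
    qed
  qed
  moreover have "\<not> colourable k d G"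
  proof
    assume "colourable k d G"
    then obtain c :: "'a \<Rightarrow> nat" where
      c: "\<And>a. a < N \<Longrightarrow> c (g a) \<in> {1..k}" "has_defect G c d"
      by (auto simp: colourable_def G_def)
    obtain v where v: "v < N"
      "d < card {u. u < N \<and> (\<exists>p. (u, v) \<in> P p \<or> (v, u) \<in> P p) \<and> c (g u) = c (g v)}"
      (is "_ < card ?S")
      using col[of "{1..k}" "\<lambda>a. c (g a)"] c(1) by (auto simp: image_subset_iff)
    have "card ?S = card (g ` ?S)"
      using g by (intro card_image[symmetric]) (auto simp: inj_on_def)
    also have "\<dots> \<le> card {w \<in> verts G. {w, g v} \<in> edges G \<and> c w = c (g v)}"
    proof (rule card_mono)
      show "g ` ?S \<subseteq> {w \<in> verts G. {w, g v} \<in> edges G \<and> c w = c (g v)}"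
        using P by (fastforce simp: G_def Q_def insert_commute)
    qed (simp add: G_def)
    also have "\<dots> \<le> d" using c(2) v(1) by (auto simp: has_defect_def G_def)
    finally show False using v(2) by simp
  qed
  ultimately show ?thesis unfolding stack_graphs_def by blast
qed

section \<open>The defective chromatic and choice numbers\<close>

lemma colourable_mono:
  assumes "colourable j d G" "j \<le> k" shows "colourable k d G"
  using assms unfolding colourable_def by (meson atLeastAtMost_iff le_trans)

lemma colourable_if_choosable:
  assumes "choosable k d G" shows "colourable k d G"
  using assms[unfolded choosable_def, rule_format, of "\<lambda>_. {1..k}"]
  unfolding colourable_def by auto

lemma Inf_enat_eqI:
  assumes "P n" "\<And>m. P m \<Longrightarrow> n \<le> m"
  shows "Inf {enat m | m. P m} = enat n"
  using assms by (intro antisym Inf_lower Inf_greatest) auto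

text \<open>Choosability implies colourability, so the choosability bound serves as upper bound for
  both numbers and the uncolourable graphs as lower bound for both.\<close>

lemma defective_numbers_stack_graphs:
  "defective_chromatic_number (stack_graphs k :: 'a::infinite graph set) = enat (k + 1)"
  "defective_choice_number (stack_graphs k :: 'a graph set) = enat (k + 1)"
proof -
  have lower: "k + 1 \<le> m" if "\<forall>G\<in>(stack_graphs k :: 'a graph set). colourable m d G" for m d
    using that exists_stack_graph_not_colourable[of k d, where 'a = 'a] colourable_mono
    by (metis not_less_eq_eq Suc_eq_plus1)
  show "defective_chromatic_number (stack_graphs k :: 'a graph set) = enat (k + 1)"
    unfolding defective_chromatic_number_def
    using stack_graph_choosable colourable_if_choosable lower by (intro Inf_enat_eqI) blast+
  show "defective_choice_number (stack_graphs k :: 'a graph set) = enat (k + 1)"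
    unfolding defective_choice_number_def
    using stack_graph_choosable colourable_if_choosable lower by (intro Inf_enat_eqI) blast+
qed

theorem theorem24:
  shows "(\<forall>k\<ge>1.
            defective_chromatic_number (stack_graphs k :: 'a::infinite graph set) = enat (k + 1) \<and>
            defective_choice_number (stack_graphs k :: 'a graph set) = enat (k + 1)) \<and>
         (\<exists>(d :: nat \<Rightarrow> nat) (f :: nat \<Rightarrow> real).
            f \<in> O(\<lambda>k. real k * ln (real k)) \<and>
            (\<forall>k\<ge>1. real (d k) = 2 powr f k \<and>
                     (\<forall>G \<in> (stack_graphs k :: 'a graph set). choosable (k + 1) (d k) G)))"
proof (intro conjI exI allI impI ballI)
  define d where "d k = 4 * k * (3 * k + 1)" for k :: nat
  \<comment> \<open>The exponent is the binary logarithm of a quadratic polynomial in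
    \<open>k\<close>, hence of logarithmic growth, well within the required bound.\<close>
  define f where "f k = log 2 (real (d k))" for k
  have "f = (\<lambda>k. log 2 (4 * real k * (3 * real k + 1)))"
    by (simp add: fun_eq_iff f_def d_def algebra_simps)
  also have "\<dots> \<in> O(\<lambda>k. real k * ln (real k))" by real_asymp
  finally show "f \<in> O(\<lambda>k. real k * ln (real k))" .
  fix k :: nat assume "k \<ge> 1"
  then have "d k > 0" by (simp add: d_def)
  then show "real (d k) = 2 powr f k" by (simp add: f_def)
  fix G :: "'a graph" assume "G \<in> stack_graphs k"
  then show "choosable (k + 1) (d k) G" unfolding d_def by (rule stack_graph_choosable)
qed (simp_all only: defective_numbers_stack_graphs)

end
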